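(* Consider an instance of the semi-infinite convex program (SICP) satisfying Assumptions 1 and 2 (both stated in the context), and an execution of the central cutting surface algorithm described in the context on this instance. Suppose that the algorithm does not terminate. Then there exists an index $\hat k$ such that the sequence $(y^{(\hat k+i)})_{i=1,2,\dots}$ consists entirely of $\varepsilon$-feasible solutions.
   Context: **Problem (SICP).** Minimize $x_0$ subject to $g(x,t)\le 0$ for all $t\in T$ and $x\in X$, where $X\subseteq\mathbb{R}^n$, $x_0$ denotes the first coordinate of $x\in\mathbb{R}^n$, $T$ is an arbitrary index set, and $g$ is a real-valued function of $x$ and $t\in T$. **Assumption 1.** (1) $X$ is convex, closed and bounded. (2) There exist a Slater point $\bar x\in X$ and $\eta>0$ with $g(\bar x,t)\le-\eta$ for every $t\in T$. (3) For every $t\in T$, $g(\cdot,t)$ is convex and subdifferentiable (on an open convex set containing $X$, with respect to which subgradients are taken), and there is $B>0$ such that for every $x\in X$, $t\in T$, every subgradient $d\in\partial_x g(x,t)$ satisfies $\|d\|\le B$. **Feasibility notion.** Let $\varepsilon\ge0$. A point $x\in X$ is $\varepsilon$-feasible if $g(x,t)\le\varepsilon$ for every $t\in T$. **Assumption 2 (oracle, with tolerance $\varepsilon$).** For every $x\in X$ that is not $\varepsilon$-feasible, the oracle returns some $t\in T$ with $g(x,t)>0$. (For $\varepsilon$-feasible $x\in X$ the oracle may return either some $t\in T$ with $g(x,t)>0$, or report that none was found.) **Central cutting surface algorithm.** Parameters: a strict upper bound $U$ on the optimal value of (SICP); $B>0$ for which Assumption 1 holds; $\varepsilon\ge0$ for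 which Assumption 2 holds; $\beta>1$ ($\beta=\infty$, meaning no cuts are dropped, is allowed). - Step 1. Set $k=1$, $y^{(0)}=(U,0,\dots,0)\in\mathbb{R}^n$, $J^{(0)}=\emptyset$. - Step 2. Determine an optimal solution $(x^{(k)},\sigma^{(k)})$ of the master problem: maximize $\sigma$ over $(x,\sigma)$ subject to $x_0+\sigma\le y_0^{(k-1)}$; $g(x,t^{(j)})+\sigma s^{(j)}\le0$ for all $j\in J^{(k-1)}$; $x\in X$. - Step 3. If $\sigma^{(k)}=0$, stop and return $y^{(k-1)}$. - Step 4. Call the oracle to find $t^{(k)}\in T$ with $g(x^{(k)},t^{(k)})>0$. If none is found, go to Step 6. - Step 5 (feasibility cut). Set $J^{(k)}=J^{(k-1)}\cup\{k\}$, $y^{(k)}=y^{(k-1)}$, and choose a centering parameter $s^{(k)}$. Go to Step 7. - Step 6 (optimality cut). Set $J^{(k)}=J^{(k-1)}$, $y^{(k)}=x^{(k)}$. - Step 7 (drop cuts). Let $D=\{j\in J^{(k)} : \sigma^{(j)}\ge\beta\sigma^{(k)}\text{ and } g(x^{(k)},t^{(j)})+\sigma^{(k)}s^{(j)}<0\}$ and replace $J^{(k)}$ by $J^{(k)}\setminus D$. - Step 8. Increase $k$ by one and go to Step 2. **Centering parameters.** They are chosen by one of two strategies: (i) $s_{\min}\le s^{(k)}\le B$ for every $k$, for a fixed $s_{\min}>0$; or (ii) $s^{(k)}=\alpha\|d\|$ with some $d\in\partial_x g(x^{(k)},t^{(k)})$ and a fixed $\alpha\in(0,1]$. *)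

theory Defs
  imports "HOL-Analysis.Analysis"
begin

text \<open>
  The problem data are: the ground set \<open>X\<close>, the index set \<open>T\<close>, the constraint function \<open>g x t\<close>,
  and a coordinate \<open>i0\<close> whose value \<open>x $ i0\<close> is the objective \<open>x\<^sub>0\<close>.
  \<open>W t\<close> is the open convex set containing \<open>X\<close> on which \<open>\<lambda>x. g x t\<close> is convex and with respect
  to which its subgradients are taken; values of \<open>g\<close> outside it play no role.
\<close>

definition subdifferential ::
  "(real^'n) set \<Rightarrow> (real^'n \<Rightarrow> real) \<Rightarrow> real^'n \<Rightarrow> (real^'n) set" where
  "subdifferential S f x = {d. \<forall>z\<in>S. f z \<ge> f x + d \<bullet> (z - x)}"

definition eps_feasible ::
  "(real^'n) set \<Rightarrow> 't set \<Rightarrow> (real^'n \<Rightarrow> 't \<Rightarrow> real) \<Rightarrow> real \<Rightarrow> real^'n \<Rightarrow> bool" where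
  "eps_feasible X T g \<epsilon> x \<longleftrightarrow> x \<in> X \<and> (\<forall>t\<in>T. g x t \<le> \<epsilon>)"

text \<open>
  The infimum is taken in the reals; under \<open>regular_instance\<close> below its range is nonempty and
  bounded.
\<close>
definition optimal_value ::
  "(real^'n) set \<Rightarrow> 't set \<Rightarrow> (real^'n \<Rightarrow> 't \<Rightarrow> real) \<Rightarrow> 'n \<Rightarrow> real" where
  "optimal_value X T g i0 = (INF x\<in>{x. eps_feasible X T g 0 x}. x $ i0)"

definition regular_instance ::
  "(real^'n) set \<Rightarrow> 't set \<Rightarrow> (real^'n \<Rightarrow> 't \<Rightarrow> real) \<Rightarrow> ('t \<Rightarrow> (real^'n) set) \<Rightarrow> real \<Rightarrow> bool" where
  "regular_instance X T g W B \<longleftrightarrow>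
     convex X \<and> closed X \<and> bounded X \<and>
     (\<exists>xbar\<in>X. \<exists>\<eta>>0. \<forall>t\<in>T. g xbar t \<le> - \<eta>) \<and>
     (\<forall>t\<in>T. open (W t) \<and> convex (W t) \<and> X \<subseteq> W t \<and>
        convex_on (W t) (\<lambda>x. g x t) \<and>
        (\<forall>x\<in>W t. subdifferential (W t) (\<lambda>z. g z t) x \<noteq> {})) \<and>
     B > 0 \<and>
     (\<forall>x\<in>X. \<forall>t\<in>T. \<forall>d\<in>subdifferential (W t) (\<lambda>z. g z t) x. norm d \<le> B)"

text \<open>
  An oracle is represented by its set of possible answers at each point, so it may be
  nondeterministic; \<open>None\<close> is the report that no violated constraint was found.
\<close>
definition valid_oracle ::
  "(real^'n) set \<Rightarrow> 't set \<Rightarrow> (real^'n \<Rightarrow> 't \<Rightarrow> real) \<Rightarrow> real \<Rightarrow> (real^'n \<Rightarrow> 't option set) \<Rightarrow> bool" where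
  "valid_oracle X T g \<epsilon> query \<longleftrightarrow>
     (\<forall>x\<in>X. query x \<noteq> {} \<and>
        (\<forall>t. Some t \<in> query x \<longrightarrow> t \<in> T \<and> g x t > 0) \<and>
        (None \<in> query x \<longrightarrow> eps_feasible X T g \<epsilon> x))"

text \<open>
  All quantities produced by the algorithm, indexed by the iteration counter.
  \<open>answer r k\<close> is the oracle's reply in iteration \<open>k\<close>: \<open>Some t\<close> leads to a feasibility cut with
  \<open>t\<^sup>(\<^sup>k\<^sup>) = t\<close>, \<open>None\<close> to an optimality cut. \<open>center r k\<close> is meaningful only in the former case,
  and \<open>cuts r k\<close> is the index set \<open>J\<^sup>(\<^sup>k\<^sup>)\<close> after cuts have been dropped.
\<close>
record ('n, 't) run =
  point  :: "nat \<Rightarrow> real^'n"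
  sigma  :: "nat \<Rightarrow> real"
  best   :: "nat \<Rightarrow> real^'n"
  cuts   :: "nat \<Rightarrow> nat set"
  answer :: "nat \<Rightarrow> 't option"
  center :: "nat \<Rightarrow> real"

definition master_feasible ::
  "(real^'n) set \<Rightarrow> (real^'n \<Rightarrow> 't \<Rightarrow> real) \<Rightarrow> 'n \<Rightarrow> ('n, 't) run \<Rightarrow> nat \<Rightarrow> ((real^'n) \<times> real) set" where
  "master_feasible X g i0 r k =
     {(z, s). z \<in> X \<and> z $ i0 + s \<le> best r (k - 1) $ i0 \<and>
        (\<forall>j\<in>cuts r (k - 1). g z (the (answer r j)) + s * center r j \<le> 0)}"

text \<open>
  Infinite \<open>\<beta>\<close> means that no cuts are dropped, whatever the sign of \<open>sigma r k\<close>; multiplying in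
  the extended reals would not give this when \<open>sigma r k < 0\<close>.
\<close>
definition dropped ::
  "(real^'n \<Rightarrow> 't \<Rightarrow> real) \<Rightarrow> ereal \<Rightarrow> ('n, 't) run \<Rightarrow> nat \<Rightarrow> nat set" where
  "dropped g \<beta> r k =
     {j. \<beta> \<noteq> \<infinity> \<and> sigma r j \<ge> real_of_ereal \<beta> * sigma r k \<and>
         g (point r k) (the (answer r j)) + sigma r k * center r j < 0}"

definition reached :: "('n::finite, 't) run \<Rightarrow> nat \<Rightarrow> bool" where
  "reached r k \<longleftrightarrow> k \<ge> 1 \<and> (\<forall>j. 1 \<le> j \<and> j < k \<longrightarrow> sigma r j \<noteq> 0)"

definition terminates :: "('n::finite, 't) run \<Rightarrow> bool" where
  "terminates r \<longleftrightarrow> (\<exists>k. reached r k \<and> sigma r k = 0)"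

definition feasibility_cut_at :: "('n::finite, 't) run \<Rightarrow> nat \<Rightarrow> bool" where
  "feasibility_cut_at r k \<longleftrightarrow> reached r k \<and> sigma r k \<noteq> 0 \<and> answer r k \<noteq> None"

definition centering_strategy ::
  "(real^'n \<Rightarrow> 't \<Rightarrow> real) \<Rightarrow> ('t \<Rightarrow> (real^'n) set) \<Rightarrow> real \<Rightarrow> ('n, 't) run \<Rightarrow> bool" where
  "centering_strategy g W B r \<longleftrightarrow>
     (\<exists>smin>0. \<forall>k. feasibility_cut_at r k \<longrightarrow> smin \<le> center r k \<and> center r k \<le> B) \<or>
     (\<exists>\<alpha>. 0 < \<alpha> \<and> \<alpha> \<le> 1 \<and>
        (\<forall>k t. feasibility_cut_at r k \<and> answer r k = Some t \<longrightarrow>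
           (\<exists>d\<in>subdifferential (W t) (\<lambda>z. g z t) (point r k). center r k = \<alpha> * norm d)))"

text \<open>
  Components of the run are unconstrained beyond the iteration in which it stops.
\<close>
definition execution ::
  "(real^'n) set \<Rightarrow> (real^'n \<Rightarrow> 't \<Rightarrow> real) \<Rightarrow> ('t \<Rightarrow> (real^'n) set) \<Rightarrow> 'n \<Rightarrow>
   (real^'n \<Rightarrow> 't option set) \<Rightarrow> real \<Rightarrow> real \<Rightarrow> ereal \<Rightarrow> ('n, 't) run \<Rightarrow> bool" where
  "execution X g W i0 query U B \<beta> r \<longleftrightarrow>
     best r 0 = axis i0 U \<and> cuts r 0 = {} \<and>
     (\<forall>k. reached r k \<longrightarrow>
        is_arg_max snd (\<lambda>p. p \<in> master_feasible X g i0 r k) (point r k, sigma r k) \<and>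
        (sigma r k \<noteq> 0 \<longrightarrow>
           answer r k \<in> query (point r k) \<and>
           (case answer r k of
              Some t \<Rightarrow> best r k = best r (k - 1) \<and>
                        cuts r k = insert k (cuts r (k - 1)) - dropped g \<beta> r k
            | None \<Rightarrow> best r k = point r k \<and>
                      cuts r k = cuts r (k - 1) - dropped g \<beta> r k))) \<and>
     centering_strategy g W B r"

end

theory Submission
  imports Defs
begin

text \<open>
  After an optimality cut the incumbent \<open>best\<close> is a point for which the oracle found no violated
  constraint, hence \<open>\<epsilon>\<close>-feasible, and it is only ever replaced by another such point. So the
  claim reduces to showing that an infinite run makes at least one optimality cut.

  Suppose instead that every iteration makes a feasibility cut. The incumbent then keeps its initial
  objective value \<open>U\<close>. As \<open>U\<close> exceeds the optimal value, moving a feasible point of value below \<open>U\<close>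
  slightly towards the Slater point gives a point that is feasible, with one and the same positive
  slack, for all master problems (\<open>sigma_bounded_below\<close>); so \<open>sigma\<close> stays above some \<open>c > 0\<close>.
  Each iteration only adds a cut and drops cuts that are strictly inactive at the optimum of a convex
  problem, which does not raise the optimum (\<open>inactive_constraints_removable\<close>); so \<open>sigma\<close> is
  nonincreasing. Its infimum being positive, all its late values agree up to a factor less than
  \<open>\<beta>\<close>, and the cuts made late are never dropped (\<open>late_cuts_kept\<close>).

  A cut made at iteration \<open>j\<close> and still present at iteration \<open>k\<close> keeps the points of the two
  iterations apart: \<open>g\<close> for the index of the cut is positive at the former and at most
  \<open>- sigma r k * center r j\<close> at the latter, while its slope is bounded by a multiple of
  \<open>center r j\<close> (\<open>cut_separates\<close>). The late points are thus pairwise separated by a fixed positive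
  distance, which is impossible in the bounded set \<open>X\<close>.
\<close>

section \<open>Separated sequences and inactive constraints\<close>

lemma compact_no_separated_sequence:
  fixes u :: "nat \<Rightarrow> 'a::metric_space"
  assumes "compact S" and "\<And>n. u n \<in> S" and "\<delta> > 0"
    and sep: "\<And>m n. m < n \<Longrightarrow> dist (u m) (u n) \<ge> \<delta>"
  shows False
proof -
  obtain l h where h: "strict_mono (h :: nat \<Rightarrow> nat)" and "(u \<circ> h) \<longlonglongrightarrow> l"
    using assms(1,2) unfolding compact_def by metis
  then have "Cauchy (u \<circ> h)"
    by (simp add: LIMSEQ_imp_Cauchy)
  then obtain M where "\<forall>m\<ge>M. \<forall>n\<ge>M. dist ((u \<circ> h) m) ((u \<circ> h) n) < \<delta>"
    using \<open>\<delta> > 0\<close> unfolding Cauchy_def by metis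
  then have "dist (u (h M)) (u (h (Suc M))) < \<delta>"
    by simp
  moreover have "h M < h (Suc M)"
    using h by (simp add: strict_mono_def)
  ultimately show False
    using sep by fastforce
qed

text \<open>
  If a point \<open>q\<close> satisfying the constraints active at \<open>p\<close> were better than \<open>p\<close>, so would be all
  points of the segment from \<open>p\<close> to \<open>q\<close> other than \<open>p\<close>; those close enough to \<open>p\<close> still satisfy
  the finitely many constraints that are strict at \<open>p\<close>.
\<close>
lemma inactive_constraints_removable:
  fixes \<phi> :: "'a::real_vector \<Rightarrow> real" and F :: "'j \<Rightarrow> 'a \<Rightarrow> real"
  assumes "convex C" and "finite J" and "linear \<phi>"
    and F: "\<And>j. j \<in> J \<Longrightarrow> convex_on C (F j)"
    and p: "p \<in> C" "\<And>j. j \<in> J \<Longrightarrow> F j p \<le> 0"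
    and opt: "\<And>z. z \<in> C \<Longrightarrow> (\<And>j. j \<in> J \<Longrightarrow> F j z \<le> 0) \<Longrightarrow> \<phi> z \<le> \<phi> p"
    and q: "q \<in> C" "\<And>j. j \<in> J \<Longrightarrow> F j p = 0 \<Longrightarrow> F j q \<le> 0"
  shows "\<phi> q \<le> \<phi> p"
proof -
  have "\<forall>\<^sub>F l in at_right 0. (1 - l) * F j p + l * F j q \<le> 0" if "j \<in> J" for j
  proof (cases "F j p = 0")
    case True
    then show ?thesis
      using q(2)[OF that] eventually_at_right_less[of "0::real"]
      by (auto elim!: eventually_mono simp: mult_nonneg_nonpos)
  next
    case False
    then have "F j p < 0"
      using p(2)[OF that] by simp
    moreover have "((\<lambda>l. (1 - l) * F j p + l * F j q) \<longlongrightarrow> (1 - 0) * F j p + 0 * F j q) (at_right 0)"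
      by (intro tendsto_intros)
    ultimately have "\<forall>\<^sub>F l in at_right 0. (1 - l) * F j p + l * F j q < 0"
      by (intro order_tendstoD(2)) auto
    then show ?thesis
      by (rule eventually_mono) simp
  qed
  then have "\<forall>\<^sub>F l in at_right 0. \<forall>j\<in>J. (1 - l) * F j p + l * F j q \<le> 0"
    using \<open>finite J\<close> by (simp add: eventually_ball_finite)
  moreover have "\<forall>\<^sub>F l in at_right (0::real). l \<in> {0<..<1}"
    by (rule eventually_at_right_real) simp
  ultimately have "\<forall>\<^sub>F l in at_right 0. (\<forall>j\<in>J. (1 - l) * F j p + l * F j q \<le> 0) \<and> l \<in> {0<..<1}"
    by (rule eventually_conj)
  then obtain l where l: "\<And>j. j \<in> J \<Longrightarrow> (1 - l) * F j p + l * F j q \<le> 0" "0 < l" "l < 1"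
    using eventually_happens by fastforce
  define z where "z = (1 - l) *\<^sub>R p + l *\<^sub>R q"
  have "z \<in> C"
    unfolding z_def using \<open>convex C\<close> p(1) q(1) l by (simp add: convexD_alt)
  moreover have "F j z \<le> 0" if "j \<in> J" for j
    unfolding z_def using convex_onD[OF F[OF that], of l p q] l(1)[OF that] l(2,3) p(1) q(1)
    by simp
  ultimately have "\<phi> z \<le> \<phi> p"
    by (rule opt)
  moreover have "\<phi> z = (1 - l) * \<phi> p + l * \<phi> q"
    unfolding z_def using \<open>linear \<phi>\<close> by (simp add: linear_add linear_cmul)
  ultimately have "l * \<phi> q \<le> l * \<phi> p"
    by (simp add: algebra_simps)
  with \<open>0 < l\<close> show ?thesis
    by simp
qed

section \<open>Nonterminating runs\<close>

locale nonterminating_run =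
  fixes X :: "(real^'n) set" and T :: "'t set" and g :: "real^'n \<Rightarrow> 't \<Rightarrow> real"
    and W :: "'t \<Rightarrow> (real^'n) set" and i0 :: 'n
    and query :: "real^'n \<Rightarrow> 't option set"
    and U B \<epsilon> :: real and \<beta> :: ereal and r :: "('n, 't) run"
  assumes inst: "regular_instance X T g W B"
    and valid_query: "valid_oracle X T g \<epsilon> query"
    and U: "U > optimal_value X T g i0"
    and \<beta>: "\<beta> > 1"
    and exec: "execution X g W i0 query U B \<beta> r"
    and nonterm: "\<not> terminates r"
begin

lemma reached: "k \<ge> 1 \<Longrightarrow> reached r k"
proof (induction k rule: less_induct)
  case (less k)
  then show ?case
    using nonterm unfolding terminates_def reached_def by auto
qed

lemma sigma_nonzero: "k \<ge> 1 \<Longrightarrow> sigma r k \<noteq> 0"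
  using reached nonterm unfolding terminates_def by blast

lemma master_optimal:
  "k \<ge> 1 \<Longrightarrow> is_arg_max snd (\<lambda>p. p \<in> master_feasible X g i0 r k) (point r k, sigma r k)"
  using exec reached unfolding execution_def by blast

lemma master_solution_feasible:
  "k \<ge> 1 \<Longrightarrow> (point r k, sigma r k) \<in> master_feasible X g i0 r k"
  using master_optimal unfolding is_arg_max_def by blast

lemma sigma_max:
  "k \<ge> 1 \<Longrightarrow> (z, s) \<in> master_feasible X g i0 r k \<Longrightarrow> s \<le> sigma r k"
  using master_optimal[of k] unfolding is_arg_max_def by (force simp: not_less)

lemma point_in: "k \<ge> 1 \<Longrightarrow> point r k \<in> X"
  using master_solution_feasible unfolding master_feasible_def by blast

lemma answer_in: "k \<ge> 1 \<Longrightarrow> answer r k \<in> query (point r k)"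
  using exec reached sigma_nonzero unfolding execution_def by blast

lemma feasibility_update:
  assumes "k \<ge> 1" and "answer r k = Some t"
  shows "best r k = best r (k - 1)"
    and "cuts r k = insert k (cuts r (k - 1)) - dropped g \<beta> r k"
proof -
  have "case answer r k of
      Some t \<Rightarrow> best r k = best r (k - 1) \<and> cuts r k = insert k (cuts r (k - 1)) - dropped g \<beta> r k
    | None \<Rightarrow> best r k = point r k \<and> cuts r k = cuts r (k - 1) - dropped g \<beta> r k"
    using exec reached sigma_nonzero \<open>k \<ge> 1\<close> unfolding execution_def by blast
  then show "best r k = best r (k - 1)"
    and "cuts r k = insert k (cuts r (k - 1)) - dropped g \<beta> r k"
    using assms(2) by simp_all
qed

lemma optimality_update:
  assumes "k \<ge> 1" and "answer r k = None"
  shows "best r k = point r k"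
proof -
  have "case answer r k of
      Some t \<Rightarrow> best r k = best r (k - 1) \<and> cuts r k = insert k (cuts r (k - 1)) - dropped g \<beta> r k
    | None \<Rightarrow> best r k = point r k \<and> cuts r k = cuts r (k - 1) - dropped g \<beta> r k"
    using exec reached sigma_nonzero \<open>k \<ge> 1\<close> unfolding execution_def by blast
  then show ?thesis
    using assms(2) by simp
qed

lemma feasible_after_optimality_cut:
  assumes "k \<ge> 1" and "answer r k = None"
  shows "eps_feasible X T g \<epsilon> (best r (k + i))"
proof (induction i)
  have *: "eps_feasible X T g \<epsilon> (best r m)" if "m \<ge> 1" "answer r m = None" for m
    using valid_query answer_in[OF that(1)] point_in[OF that(1)] optimality_update[OF that] that(2)
    unfolding valid_oracle_def by auto
  {
    case 0
    show ?case
      using *[OF assms] by simp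
  next
    case (Suc i)
    show ?case
    proof (cases "answer r (k + Suc i)")
      case None
      then show ?thesis
        using * by simp
    next
      case (Some t)
      then show ?thesis
        using feasibility_update(1)[of "k + Suc i" t] Suc by simp
    qed
  }
qed

lemma compact_X: "compact X"
  using inst unfolding regular_instance_def by (simp add: compact_eq_bounded_closed)

lemma convex_X: "convex X"
  using inst unfolding regular_instance_def by blast

lemma convex_g:
  assumes "t \<in> T"
  shows "convex_on X (\<lambda>x. g x t)"
proof (rule convex_on_subset)
  show "convex_on (W t) (\<lambda>x. g x t)" "X \<subseteq> W t" "convex X"
    using inst assms unfolding regular_instance_def by auto
qed

lemma B_pos: "B > 0"
  using inst unfolding regular_instance_def by auto

lemma subgradient_exists:
  assumes "t \<in> T" and "x \<in> X"
  shows "\<exists>d. d \<in> subdifferential (W t) (\<lambda>z. g z t) x"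
proof -
  have "x \<in> W t" "\<forall>x\<in>W t. subdifferential (W t) (\<lambda>z. g z t) x \<noteq> {}"
    using inst assms unfolding regular_instance_def by auto
  then show ?thesis
    by auto
qed

lemma subgradient_bound:
  assumes "t \<in> T" and "x \<in> X" and "d \<in> subdifferential (W t) (\<lambda>z. g z t) x"
  shows "norm d \<le> B"
  using inst assms unfolding regular_instance_def by simp

lemma subgradient_inequality:
  assumes "t \<in> T" and "z \<in> X" and "d \<in> subdifferential (W t) (\<lambda>z. g z t) x"
  shows "g z t \<ge> g x t + d \<bullet> (z - x)"
proof -
  have "z \<in> W t"
    using inst assms(1,2) unfolding regular_instance_def by auto
  then show ?thesis
    using assms(3) unfolding subdifferential_def by simp
qed

text \<open>
  The segment from a feasible point of value below \<open>U\<close> to the Slater point starts below \<open>U\<close>, and by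
  convexity all its other points are Slater points.
\<close>
lemma slater_point_below_U:
  obtains z \<eta> where "z \<in> X" "z $ i0 < U" "\<eta> > 0" "\<And>t. t \<in> T \<Longrightarrow> g z t \<le> - \<eta>"
proof -
  obtain xbar \<eta> where xbar: "xbar \<in> X" "\<eta> > 0" "\<And>t. t \<in> T \<Longrightarrow> g xbar t \<le> - \<eta>"
    using inst unfolding regular_instance_def by blast
  then have "eps_feasible X T g 0 xbar"
    unfolding eps_feasible_def by fastforce
  then have "{x. eps_feasible X T g 0 x} \<noteq> {}"
    by blast
  then have "U \<le> optimal_value X T g i0" if "\<And>x. eps_feasible X T g 0 x \<Longrightarrow> U \<le> x $ i0"
    unfolding optimal_value_def using that by (intro cINF_greatest) auto
  then have "\<exists>x. eps_feasible X T g 0 x \<and> x $ i0 < U"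
    using U by (meson not_le)
  then obtain x where x: "x \<in> X" "\<And>t. t \<in> T \<Longrightarrow> g x t \<le> 0" "x $ i0 < U"
    unfolding eps_feasible_def by blast
  have "((\<lambda>l. ((1 - l) *\<^sub>R x + l *\<^sub>R xbar) $ i0) \<longlongrightarrow> ((1 - 0) *\<^sub>R x + 0 *\<^sub>R xbar) $ i0) (at_right 0)"
    by (intro tendsto_intros)
  then have "\<forall>\<^sub>F l in at_right 0. ((1 - l) *\<^sub>R x + l *\<^sub>R xbar) $ i0 < U"
    by (rule order_tendstoD(2)) (simp add: x(3))
  moreover have "\<forall>\<^sub>F l in at_right (0::real). l \<in> {0<..<1}"
    by (rule eventually_at_right_real) simp
  ultimately have "\<forall>\<^sub>F l in at_right 0. ((1 - l) *\<^sub>R x + l *\<^sub>R xbar) $ i0 < U \<and> l \<in> {0<..<1}"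
    by (rule eventually_conj)
  then obtain l where l: "((1 - l) *\<^sub>R x + l *\<^sub>R xbar) $ i0 < U" "0 < l" "l < 1"
    using eventually_happens by fastforce
  show thesis
  proof
    show "(1 - l) *\<^sub>R x + l *\<^sub>R xbar \<in> X"
      using convex_X x(1) xbar(1) l by (simp add: convexD_alt)
    show "l * \<eta> > 0"
      using l xbar(2) by simp
    fix t
    assume t: "t \<in> T"
    have "g ((1 - l) *\<^sub>R x + l *\<^sub>R xbar) t \<le> (1 - l) * g x t + l * g xbar t"
      using convex_onD[OF convex_g[OF t], of l x xbar] l x(1) xbar(1) by simp
    also have "\<dots> \<le> (1 - l) * 0 + l * (- \<eta>)"
      using l x(2)[OF t] xbar(3)[OF t] by (intro add_mono mult_left_mono) auto
    finally show "g ((1 - l) *\<^sub>R x + l *\<^sub>R xbar) t \<le> - (l * \<eta>)"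
      by simp
  qed (rule l(1))
qed

end

section \<open>Runs without optimality cuts\<close>

locale run_without_optimality_cuts = nonterminating_run +
  assumes feasibility_cuts: "\<And>k. k \<ge> 1 \<Longrightarrow> answer r k \<noteq> None"
begin

lemma answer_violated:
  assumes "k \<ge> 1"
  shows "the (answer r k) \<in> T" and "g (point r k) (the (answer r k)) > 0"
  using valid_query answer_in[OF assms] point_in[OF assms] feasibility_cuts[OF assms]
  unfolding valid_oracle_def by auto

lemma best_const: "best r k $ i0 = U"
proof (induction k)
  case 0
  then show ?case
    using exec unfolding execution_def by (simp add: axis_def)
next
  case (Suc k)
  then show ?case
    using feasibility_update(1)[of "Suc k"] feasibility_cuts[of "Suc k"] by auto
qed

lemma cuts_Suc: "cuts r (Suc k) = insert (Suc k) (cuts r k) - dropped g \<beta> r (Suc k)"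
  using feasibility_update(2)[of "Suc k"] feasibility_cuts[of "Suc k"] by auto

lemma cuts_subset: "cuts r k \<subseteq> {1..k}"
proof (induction k)
  case 0
  then show ?case
    using exec unfolding execution_def by simp
next
  case (Suc k)
  then show ?case
    unfolding cuts_Suc by fastforce
qed

lemma master_feasible_iff:
  assumes "k \<ge> 1"
  shows "(z, s) \<in> master_feasible X g i0 r k \<longleftrightarrow>
    z \<in> X \<and> z $ i0 + s \<le> U \<and> (\<forall>j\<in>cuts r (k - 1). g z (the (answer r j)) + s * center r j \<le> 0)"
  unfolding master_feasible_def by (simp add: best_const)

text \<open>
  Both strategies make the centering parameter at least a fixed multiple of the norm of some
  subgradient: in the first, of any subgradient, with factor \<open>smin / B\<close>; in the second, of the chosen
  one, with factor \<open>\<alpha>\<close>.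
\<close>
lemma centering_bounds:
  obtains \<delta> where "\<delta> > 0"
    and "\<And>k. k \<ge> 1 \<Longrightarrow> center r k \<le> B"
    and "\<And>k. k \<ge> 1 \<Longrightarrow> \<exists>d\<in>subdifferential (W (the (answer r k))) (\<lambda>z. g z (the (answer r k))) (point r k).
           \<delta> * norm d \<le> center r k"
proof -
  have cut: "feasibility_cut_at r k" if "k \<ge> 1" for k
    unfolding feasibility_cut_at_def using that reached sigma_nonzero feasibility_cuts by blast
  consider smin where "smin > 0" "\<And>k. k \<ge> 1 \<Longrightarrow> smin \<le> center r k \<and> center r k \<le> B"
    | \<alpha> where "0 < \<alpha>" "\<alpha> \<le> 1"
      "\<And>k. k \<ge> 1 \<Longrightarrow> \<exists>d\<in>subdifferential (W (the (answer r k))) (\<lambda>z. g z (the (answer r k))) (point r k).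
         center r k = \<alpha> * norm d"
  proof -
    from exec have "centering_strategy g W B r"
      unfolding execution_def by blast
    then show thesis
      unfolding centering_strategy_def
    proof (elim disjE exE conjE)
      fix smin :: real
      assume "smin > 0" "\<forall>k. feasibility_cut_at r k \<longrightarrow> smin \<le> center r k \<and> center r k \<le> B"
      then show thesis
        using that(1) cut by blast
    next
      fix \<alpha> :: real
      assume "0 < \<alpha>" "\<alpha> \<le> 1"
        and *: "\<forall>k t. feasibility_cut_at r k \<and> answer r k = Some t \<longrightarrow>
          (\<exists>d\<in>subdifferential (W t) (\<lambda>z. g z t) (point r k). center r k = \<alpha> * norm d)"
      then show thesis
        using that(2)[of \<alpha>] cut feasibility_cuts option.collapse by metis
    qed
  qed
  then show thesis
  proof cases
    case 1
    show thesis
    proof (rule that[of "smin / B"])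
      show "smin / B > 0"
        using 1(1) B_pos by simp
      show "center r k \<le> B" if "k \<ge> 1" for k
        using 1(2) that by blast
      fix k :: nat
      assume k: "k \<ge> 1"
      obtain d where d: "d \<in> subdifferential (W (the (answer r k))) (\<lambda>z. g z (the (answer r k))) (point r k)"
        using subgradient_exists answer_violated(1)[OF k] point_in[OF k] by blast
      then have "norm d \<le> B"
        using subgradient_bound answer_violated(1)[OF k] point_in[OF k] by blast
      then have "smin / B * norm d \<le> smin / B * B"
        using 1(1) B_pos by (intro mult_left_mono) auto
      also have "\<dots> \<le> center r k"
        using 1(2)[OF k] B_pos by simp
      finally show "\<exists>d\<in>subdifferential (W (the (answer r k))) (\<lambda>z. g z (the (answer r k))) (point r k).
          smin / B * norm d \<le> center r k"
        using d by blast
    qed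
  next
    case 2
    show thesis
    proof (rule that[of \<alpha>])
      fix k :: nat
      assume k: "k \<ge> 1"
      obtain d where d: "d \<in> subdifferential (W (the (answer r k))) (\<lambda>z. g z (the (answer r k))) (point r k)"
        and center: "center r k = \<alpha> * norm d"
        using 2(3)[OF k] by blast
      have "\<alpha> * norm d \<le> norm d"
        using 2(1,2) by (simp add: mult_left_le_one_le)
      also have "\<dots> \<le> B"
        using d subgradient_bound answer_violated(1)[OF k] point_in[OF k] by blast
      finally show "center r k \<le> B"
        using center by simp
      show "\<exists>d\<in>subdifferential (W (the (answer r k))) (\<lambda>z. g z (the (answer r k))) (point r k).
          \<alpha> * norm d \<le> center r k"
        using d center by force
    qed (rule 2(1))
  qed
qed

lemma sigma_bounded_below:
  obtains c where "c > 0" and "\<And>k. k \<ge> 1 \<Longrightarrow> c \<le> sigma r k"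
proof -
  obtain z \<eta> where z: "z \<in> X" "z $ i0 < U" "\<eta> > 0" "\<And>t. t \<in> T \<Longrightarrow> g z t \<le> - \<eta>"
    by (rule slater_point_below_U) blast
  obtain \<delta> :: real where center_le: "\<And>k. k \<ge> 1 \<Longrightarrow> center r k \<le> B"
    by (rule centering_bounds) blast
  \<comment> \<open>No cut asks for more than \<open>c * B\<close> below zero, and \<open>z\<close> is \<open>\<eta>\<close> below.\<close>
  define c where "c = min (U - z $ i0) (\<eta> / B)"
  have "c > 0"
    unfolding c_def using z B_pos by simp
  moreover have "c \<le> sigma r k" if k: "k \<ge> 1" for k
  proof -
    have "g z (the (answer r j)) + c * center r j \<le> 0" if "j \<in> cuts r (k - 1)" for j
    proof -
      have j: "j \<ge> 1"
        using cuts_subset that by fastforce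
      have "c * center r j \<le> c * B"
        using \<open>c > 0\<close> center_le[OF j] by simp
      also have "\<dots> \<le> \<eta> / B * B"
        unfolding c_def using B_pos by (intro mult_right_mono) auto
      also have "\<dots> = \<eta>"
        using B_pos by simp
      finally show ?thesis
        using z(4)[OF answer_violated(1)[OF j]] by simp
    qed
    moreover have "z $ i0 + c \<le> U"
      unfolding c_def by simp
    ultimately show ?thesis
      using sigma_max[OF k] master_feasible_iff[OF k] z(1) by blast
  qed
  ultimately show thesis
    by (rule that)
qed

lemma sigma_Suc_le:
  assumes k: "k \<ge> 1"
  shows "sigma r (Suc k) \<le> sigma r k"
proof -
  define C where "C = {p. fst p \<in> X \<and> fst p $ i0 + snd p \<le> U}"
  define F where "F j p = g (fst p) (the (answer r j)) + snd p * center r j" for j and p :: "(real^'a) \<times> real"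
  have mf: "p \<in> master_feasible X g i0 r m \<longleftrightarrow> p \<in> C \<and> (\<forall>j\<in>cuts r (m - 1). F j p \<le> 0)"
    if "m \<ge> 1" for m p
    using master_feasible_iff[OF that, of "fst p" "snd p"] unfolding C_def F_def by auto
  have "convex C"
  proof (rule convexI)
    fix p q and u v :: real
    assume pq: "p \<in> C" "q \<in> C" and uv: "0 \<le> u" "0 \<le> v" "u + v = 1"
    have "u *\<^sub>R fst p + v *\<^sub>R fst q \<in> X"
      using convex_X pq uv unfolding C_def by (simp add: convexD)
    moreover have "u * (fst p $ i0 + snd p) + v * (fst q $ i0 + snd q) \<le> U"
      using pq uv unfolding C_def by (intro convex_bound_le) auto
    ultimately show "u *\<^sub>R p + v *\<^sub>R q \<in> C"
      unfolding C_def by (simp add: algebra_simps)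
  qed
  moreover have "finite (cuts r (k - 1))"
    using cuts_subset finite_subset by blast
  moreover have "linear (snd :: (real^'a) \<times> real \<Rightarrow> real)"
    by (rule linear_snd)
  moreover have "convex_on C (F j)" if "j \<in> cuts r (k - 1)" for j
  proof (rule convex_onI)
    show "convex C" by fact
    fix l :: real and p q
    assume l: "0 < l" "l < 1" and pq: "p \<in> C" "q \<in> C"
    have "the (answer r j) \<in> T"
      using answer_violated(1) cuts_subset that by (metis atLeastAtMost_iff subsetD)
    then have "g ((1 - l) *\<^sub>R fst p + l *\<^sub>R fst q) (the (answer r j))
        \<le> (1 - l) * g (fst p) (the (answer r j)) + l * g (fst q) (the (answer r j))"
      using convex_onD[OF convex_g, of "the (answer r j)" l "fst p" "fst q"] l pq
      unfolding C_def by simp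
    then show "F j ((1 - l) *\<^sub>R p + l *\<^sub>R q) \<le> (1 - l) * F j p + l * F j q"
      unfolding F_def by (simp add: algebra_simps)
  qed
  moreover have feas: "(point r k, sigma r k) \<in> C"
    "\<And>j. j \<in> cuts r (k - 1) \<Longrightarrow> F j (point r k, sigma r k) \<le> 0"
    using master_solution_feasible[OF k] mf[OF k] by blast+
  moreover have "snd p \<le> snd (point r k, sigma r k)"
    if "p \<in> C" "\<And>j. j \<in> cuts r (k - 1) \<Longrightarrow> F j p \<le> 0" for p
    using sigma_max[OF k, of "fst p" "snd p"] mf[OF k] that by simp
  moreover have "(point r (Suc k), sigma r (Suc k)) \<in> C"
    using master_solution_feasible[of "Suc k"] mf by simp
  moreover have "F j (point r (Suc k), sigma r (Suc k)) \<le> 0"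
    if j: "j \<in> cuts r (k - 1)" "F j (point r k, sigma r k) = 0" for j
  proof -
    have "j \<notin> dropped g \<beta> r k"
      using j(2) unfolding dropped_def F_def by simp
    then have "j \<in> cuts r k"
      using cuts_Suc[of "k - 1"] j(1) k by simp
    then show ?thesis
      using master_solution_feasible[of "Suc k"] mf by simp
  qed
  ultimately have "snd (point r (Suc k), sigma r (Suc k)) \<le> snd (point r k, sigma r k)"
    by (rule inactive_constraints_removable)
  then show ?thesis
    by simp
qed

lemma sigma_antimono:
  assumes "1 \<le> j" and "j \<le> k"
  shows "sigma r k \<le> sigma r j"
  using assms(2)
proof (induction k rule: dec_induct)
  case (step n)
  then show ?case
    using sigma_Suc_le[of n] \<open>1 \<le> j\<close> by simp
qed simp

lemma late_cuts_kept:
  obtains K where "K \<ge> 1" and "\<And>j k. K \<le> j \<Longrightarrow> j \<le> k \<Longrightarrow> j \<in> cuts r k"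
proof -
  obtain c where c: "c > 0" "\<And>k. k \<ge> 1 \<Longrightarrow> c \<le> sigma r k"
    by (rule sigma_bounded_below) blast
  have "\<exists>K\<ge>1. \<forall>j\<ge>K. \<forall>k\<ge>j. j \<notin> dropped g \<beta> r k"
  proof (cases "\<beta> = \<infinity>")
    case True
    then show ?thesis
      unfolding dropped_def by auto
  next
    case False
    then obtain b where b: "\<beta> = ereal b" "b > 1"
      using \<beta> by (cases \<beta>) auto
    define L where "L = (INF k\<in>{1..}. sigma r k)"
    have bdd: "bdd_below (sigma r ` {1..})"
      using c(2) by (auto intro!: bdd_belowI)
    have L_le: "L \<le> sigma r k" if "k \<ge> 1" for k
      unfolding L_def using that by (intro cINF_lower[OF bdd]) simp
    have "c \<le> L"
      unfolding L_def using c(2) by (intro cINF_greatest) auto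
    then have "L < b * L"
      using c(1) b(2) by simp
    then obtain K where K: "K \<ge> 1" "sigma r K < b * L"
      using cINF_less_iff[of "{1..}" "sigma r" "b * L"] bdd unfolding L_def by auto
    have "j \<notin> dropped g \<beta> r k" if "K \<le> j" "j \<le> k" for j k
    proof -
      have "sigma r j \<le> sigma r K"
        using sigma_antimono K(1) that(1) by blast
      also have "\<dots> < b * L"
        by (rule K(2))
      also have "\<dots> \<le> b * sigma r k"
        using L_le[of k] K(1) that b(2) by simp
      finally show ?thesis
        unfolding dropped_def b(1) by simp
    qed
    with K(1) show ?thesis
      by blast
  qed
  then obtain K where K: "K \<ge> 1" "\<And>j k. K \<le> j \<Longrightarrow> j \<le> k \<Longrightarrow> j \<notin> dropped g \<beta> r k"
    by blast
  have "j \<in> cuts r k" if "K \<le> j" "j \<le> k" for j k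
    using \<open>j \<le> k\<close>
  proof (induction k rule: dec_induct)
    case base
    then show ?case
      using K(1) K(2)[of j j] \<open>K \<le> j\<close> cuts_Suc[of "j - 1"] by simp
  next
    case (step n)
    then show ?case
      using K(2)[of j "Suc n"] \<open>K \<le> j\<close> cuts_Suc[of n] by simp
  qed
  with K(1) show thesis
    by (rule that)
qed

text \<open>
  From \<open>point r j\<close> to \<open>point r k\<close> the cut function falls by more than
  \<open>sigma r k * center r j \<ge> sigma r k * \<delta> * norm d\<close>, whereas a subgradient \<open>d\<close> at \<open>point r j\<close>
  allows it to fall by at most \<open>norm d\<close> times the distance.
\<close>
lemma cut_separates:
  obtains \<delta> where "\<delta> > 0"
    and "\<And>j k. k \<ge> 1 \<Longrightarrow> j \<in> cuts r (k - 1) \<Longrightarrow> sigma r k \<ge> 0 \<Longrightarrow> \<delta> * sigma r k \<le> dist (point r j) (point r k)"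
proof -
  obtain \<delta> where \<delta>: "\<delta> > 0"
    "\<And>k. k \<ge> 1 \<Longrightarrow> \<exists>d\<in>subdifferential (W (the (answer r k))) (\<lambda>z. g z (the (answer r k))) (point r k).
       \<delta> * norm d \<le> center r k"
    by (rule centering_bounds) blast
  have "\<delta> * sigma r k \<le> dist (point r j) (point r k)"
    if k: "k \<ge> 1" and jk: "j \<in> cuts r (k - 1)" and nonneg: "sigma r k \<ge> 0" for j k
  proof -
    let ?t = "the (answer r j)"
    have j: "j \<ge> 1"
      using cuts_subset jk by fastforce
    obtain d where d: "d \<in> subdifferential (W ?t) (\<lambda>z. g z ?t) (point r j)" "\<delta> * norm d \<le> center r j"
      using \<delta>(2)[OF j] by blast
    have "sigma r k * (\<delta> * norm d) \<le> sigma r k * center r j"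
      using d(2) nonneg by (rule mult_left_mono)
    also have "\<dots> \<le> - g (point r k) ?t"
      using master_solution_feasible[OF k] jk unfolding master_feasible_def by fastforce
    also have "\<dots> \<le> - g (point r j) ?t - d \<bullet> (point r k - point r j)"
      using subgradient_inequality[OF answer_violated(1)[OF j] point_in[OF k] d(1)] by simp
    also have "\<dots> < d \<bullet> (point r j - point r k)"
      using answer_violated(2)[OF j] by (simp add: inner_diff_right)
    also have "\<dots> \<le> norm d * dist (point r j) (point r k)"
      unfolding dist_norm by (rule norm_cauchy_schwarz)
    finally have less: "norm d * (\<delta> * sigma r k) < norm d * dist (point r j) (point r k)"
      by (simp add: mult_ac)
    then show ?thesis
      by (simp add: mult_less_cancel_left)
  qed
  with \<delta>(1) show thesis
    by (rule that)
qed

lemma contradiction: False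
proof -
  obtain c where c: "c > 0" "\<And>k. k \<ge> 1 \<Longrightarrow> c \<le> sigma r k"
    by (rule sigma_bounded_below) blast
  obtain K where K: "K \<ge> 1" "\<And>j k. K \<le> j \<Longrightarrow> j \<le> k \<Longrightarrow> j \<in> cuts r k"
    by (rule late_cuts_kept) blast
  obtain \<delta> where \<delta>: "\<delta> > 0"
    "\<And>j k. k \<ge> 1 \<Longrightarrow> j \<in> cuts r (k - 1) \<Longrightarrow> sigma r k \<ge> 0 \<Longrightarrow> \<delta> * sigma r k \<le> dist (point r j) (point r k)"
    by (rule cut_separates) blast
  have "\<delta> * c \<le> dist (point r (K + m)) (point r (K + n))" if "m < n" for m n
  proof -
    have "c \<le> sigma r (K + n)"
      using c(2) K(1) by simp
    then have "\<delta> * c \<le> \<delta> * sigma r (K + n)"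
      using \<delta>(1) by simp
    also have "\<dots> \<le> dist (point r (K + m)) (point r (K + n))"
    proof (rule \<delta>(2))
      show "K + m \<in> cuts r (K + n - 1)"
        using that by (intro K(2)) auto
    qed (use K(1) c(1) \<open>c \<le> sigma r (K + n)\<close> in auto)
    finally show ?thesis .
  qed
  moreover have "point r (K + n) \<in> X" for n
    using point_in K(1) by simp
  ultimately show False
    using compact_no_separated_sequence[OF compact_X, of "\<lambda>n. point r (K + n)" "\<delta> * c"] c(1) \<delta>(1)
    by simp
qed

end

section \<open>Eventual feasibility\<close>

theorem theorem3:
  fixes X :: "(real^'n) set" and T :: "'t set" and g :: "real^'n \<Rightarrow> 't \<Rightarrow> real"
    and W :: "'t \<Rightarrow> (real^'n) set" and i0 :: 'n
    and query :: "real^'n \<Rightarrow> 't option set"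
    and U B \<epsilon> :: real and \<beta> :: ereal and r :: "('n, 't) run"
  assumes "regular_instance X T g W B"
    and "\<epsilon> \<ge> 0"
    and "valid_oracle X T g \<epsilon> query"
    and "U > optimal_value X T g i0"
    and "\<beta> > 1"
    and "execution X g W i0 query U B \<beta> r"
    and "\<not> terminates r"
  shows "\<exists>khat. \<forall>i\<ge>1. eps_feasible X T g \<epsilon> (best r (khat + i))"
proof -
  interpret nonterminating_run X T g W i0 query U B \<epsilon> \<beta> r
    by unfold_locales (use assms in auto)
  have "\<exists>k\<ge>1. answer r k = None"
  proof (rule ccontr)
    assume "\<not> ?thesis"
    then interpret run_without_optimality_cuts X T g W i0 query U B \<epsilon> \<beta> r
      by unfold_locales auto
    show False
      by (rule contradiction)
  qed
  then obtain k where k: "k \<ge> 1" "answer r k = None"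
    by blast
  show ?thesis
  proof (intro exI allI impI)
    fix i :: nat
    show "eps_feasible X T g \<epsilon> (best r (k + i))"
      by (rule feasible_after_optimality_cut[OF k])
  qed
qed

end
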